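(* Let $a,b\ge0$, $n\ge1$ and $T\in\mathrm{SHST}(a,b,n)$. Then the depth sequence of the reading word $\mathrm{rw}(T)$ depends only on the first row of $T$; in particular, for each $1\le j\le a+b$, $\mathrm{depth}_j(\mathrm{rw}(T))$ equals the number of entries equal to $j+1$ in the first row of $T$.
   Context: $\mathrm{SHST}(a,b,n)$ is the set of semistandard Young tableaux of shape $(n(a+1),n^b)$ (first row $n(a+1)$ boxes, then $b$ rows of $n$ boxes) with each of $1,\dots,a+b+1$ occurring exactly $n$ times. The reading word $\mathrm{rw}(T)$ lists entries row by row, left to right, bottom row first. For a word $w$ and $j\ge1$, $\mathrm{depth}_j(w)$: take the subword of letters $j,j+1$, repeatedly delete adjacent pairs "$j+1$ immediately followed by $j$"; the result is $j^r(j+1)^s$ and $\mathrm{depth}_j(w)=s$. The depth sequence is $(\mathrm{depth}_1(w),\mathrm{depth}_2(w),\dots)$. *)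

theory Defs
  imports Main
begin

text \<open>A tableau is the list of its rows, top row first (English convention).\<close>

definition semistandard :: "nat list list \<Rightarrow> bool" where
  "semistandard T \<longleftrightarrow>
     (\<forall>row \<in> set T. sorted row \<and> (\<forall>x \<in> set row. 1 \<le> x)) \<and>
     (\<forall>i c. Suc i < length T \<longrightarrow> c < length (T ! Suc i) \<longrightarrow> T ! i ! c < T ! Suc i ! c)"

definition SHST :: "nat \<Rightarrow> nat \<Rightarrow> nat \<Rightarrow> nat list list set" where
  "SHST a b n =
     {T. map length T = n * (a + 1) # replicate b n \<and> semistandard T \<and>
         (\<forall>k \<in> {1..a + b + 1}. count_list (concat T) k = n)}"

definition rw :: "nat list list \<Rightarrow> nat list" where
  "rw T = concat (rev T)"

inductive delete_pair :: "nat \<Rightarrow> nat list \<Rightarrow> nat list \<Rightarrow> bool" for j where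
  "delete_pair j (u @ [Suc j, j] @ v) (u @ v)"

definition depth :: "nat \<Rightarrow> nat list \<Rightarrow> nat" where
  "depth j w =
     (THE s. \<exists>r. (delete_pair j)\<^sup>*\<^sup>* (filter (\<lambda>x. x = j \<or> x = Suc j) w)
                   (replicate r j @ replicate s (Suc j)))"

text \<open>The sequence \<open>(depth\<^sub>1(w), depth\<^sub>2(w), \<dots>)\<close>, indexed from \<open>0\<close>.\<close>

definition depth_seq :: "nat list \<Rightarrow> nat \<Rightarrow> nat" where
  "depth_seq w i = depth (Suc i) w"

text \<open>The remaining facts show that the definite description in \<^const>\<open>depth\<close> is well defined:
  the deletion process can always be completed, and its result does not depend on the order of
  the deletions.\<close>

fun reduced :: "nat \<Rightarrow> nat list \<Rightarrow> nat \<times> nat" where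
  "reduced j [] = (0, 0)"
| "reduced j (x # xs) =
     (let (r, s) = reduced j xs in
      if x = j then (Suc r, s) else if r = 0 then (0, Suc s) else (r - 1, s))"

lemma reduced_append_cong: "reduced j v = reduced j v' \<Longrightarrow> reduced j (u @ v) = reduced j (u @ v')"
  by (induction u) auto

lemma reduced_delete_pair: "delete_pair j w w' \<Longrightarrow> reduced j w = reduced j w'"
  by (erule delete_pair.cases) (auto intro!: reduced_append_cong split: prod.split)

lemma reduced_delete_pairs: "(delete_pair j)\<^sup>*\<^sup>* w w' \<Longrightarrow> reduced j w = reduced j w'"
  by (induction rule: rtranclp_induct) (auto dest: reduced_delete_pair)

lemma reduced_normal: "reduced j (replicate r j @ replicate s (Suc j)) = (r, s)"
proof -
  have "reduced j (replicate s (Suc j)) = (0, s)" by (induction s) auto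
  then show ?thesis by (induction r) auto
qed

lemma delete_pair_Cons: "delete_pair j w w' \<Longrightarrow> delete_pair j (x # w) (x # w')"
  by (erule delete_pair.cases) (metis append_Cons delete_pair.intros)

lemma delete_pairs_Cons: "(delete_pair j)\<^sup>*\<^sup>* w w' \<Longrightarrow> (delete_pair j)\<^sup>*\<^sup>* (x # w) (x # w')"
  by (induction rule: rtranclp_induct) (auto intro: rtranclp.rtrancl_into_rtrancl delete_pair_Cons)

lemma delete_pairs_normal_form_ex:
  assumes "set w \<subseteq> {j, Suc j}"
  shows "\<exists>r s. (delete_pair j)\<^sup>*\<^sup>* w (replicate r j @ replicate s (Suc j))"
  using assms
proof (induction w)
  case Nil
  have "(delete_pair j)\<^sup>*\<^sup>* [] (replicate 0 j @ replicate 0 (Suc j))" by simp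
  then show ?case by blast
next
  case (Cons x w)
  then obtain r s where "(delete_pair j)\<^sup>*\<^sup>* w (replicate r j @ replicate s (Suc j))" by auto
  then have *: "(delete_pair j)\<^sup>*\<^sup>* (x # w) (x # replicate r j @ replicate s (Suc j))"
    by (rule delete_pairs_Cons)
  consider "x = j" | "x = Suc j" "r = 0" | r' where "x = Suc j" "r = Suc r'"
    using Cons.prems by (cases r) auto
  then show ?case
  proof cases
    case 1
    then have "x # replicate r j @ replicate s (Suc j) = replicate (Suc r) j @ replicate s (Suc j)"
      by simp
    then show ?thesis using * by metis
  next
    case 2
    then have "x # replicate r j @ replicate s (Suc j) = replicate 0 j @ replicate (Suc s) (Suc j)"
      by simp
    then show ?thesis using * by metis
  next
    case 3
    have "delete_pair j ([] @ [Suc j, j] @ (replicate r' j @ replicate s (Suc j)))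
            ([] @ (replicate r' j @ replicate s (Suc j)))"
      by (rule delete_pair.intros)
    then have "delete_pair j (x # replicate r j @ replicate s (Suc j))
                 (replicate r' j @ replicate s (Suc j))"
      using 3 by simp
    then show ?thesis using * by (meson rtranclp.rtrancl_into_rtrancl)
  qed
qed

lemma depth_well_defined:
  "\<exists>!s. \<exists>r. (delete_pair j)\<^sup>*\<^sup>* (filter (\<lambda>x. x = j \<or> x = Suc j) w)
               (replicate r j @ replicate s (Suc j))"
proof -
  have "set (filter (\<lambda>x. x = j \<or> x = Suc j) w) \<subseteq> {j, Suc j}" by auto
  then obtain r s where
    "(delete_pair j)\<^sup>*\<^sup>* (filter (\<lambda>x. x = j \<or> x = Suc j) w) (replicate r j @ replicate s (Suc j))"
    using delete_pairs_normal_form_ex by blast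
  then show ?thesis
    by (metis reduced_delete_pairs reduced_normal snd_conv)
qed

end

theory Submission
  imports Defs
begin

text \<open>The depth is the maximum, over all suffixes \<open>v\<close> of the word, of the number of letters
  \<open>j + 1\<close> minus the number of letters \<open>j\<close> in \<open>v\<close>. The part of the first row exceeding \<open>j\<close> is a
  suffix realising the claimed value. For the upper bound, let a suffix begin in a lower row \<open>R\<close>.
  As \<open>j\<close> occurs \<open>n\<close> times in total, it suffices that the letters \<open>j + 1\<close> in the lower rows down
  to \<open>R\<close>, together with the letters \<open>j\<close> in the rows from \<open>R\<close> on, number at most \<open>n\<close>. By column
  strictness no two of these lie in the same column, and the lower rows have only \<open>n\<close> columns.\<close>

text \<open>Trades the definite description for a recursion on which the later inductions can run:
  deletions preserve \<open>reduced\<close>, and a normal form is mapped to its pair of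
  exponents.\<close>

lemma depth_eq_reduced: "depth j w = snd (reduced j (filter (\<lambda>x. x = j \<or> x = Suc j) w))"
proof -
  let ?w = "filter (\<lambda>x. x = j \<or> x = Suc j) w"
  have "\<exists>r. (delete_pair j)\<^sup>*\<^sup>* ?w (replicate r j @ replicate (depth j w) (Suc j))"
    unfolding depth_def by (rule theI'[OF depth_well_defined])
  then show ?thesis
    by (metis reduced_delete_pairs reduced_normal snd_conv)
qed

text \<open>Each deletion removes one letter of each kind, so the difference of the two counts is
  that of the normal form. The additive form avoids truncated subtraction.\<close>

lemma reduced_balance:
  "reduced j (filter (\<lambda>x. x = j \<or> x = Suc j) w) = (r, s) \<Longrightarrow>
     count_list w (Suc j) + r = count_list w j + s"
  by (induction w arbitrary: r s) (auto split: prod.splits if_splits)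

text \<open>A letter put in front changes \<open>r\<close>, or raises \<open>s\<close> when it is
  \<open>Suc j\<close> and \<open>r = 0\<close>; it never lowers \<open>s\<close>.\<close>

lemma depth_append_ge: "depth j v \<le> depth j (u @ v)"
  unfolding depth_eq_reduced
  by (induction u) (auto split: prod.splits)

lemma count_suffix_le_depth: "count_list v (Suc j) \<le> count_list v j + depth j (u @ v)"
proof -
  have "count_list v (Suc j) \<le> count_list v j + depth j v"
    unfolding depth_eq_reduced using reduced_balance[of j v]
    by (metis le_add1 prod.collapse)
  then show ?thesis
    using depth_append_ge[of j v u] by linarith
qed

lemma depth_attained_by_suffix:
  "\<exists>u v. w = u @ v \<and> count_list v (Suc j) = count_list v j + depth j w"
proof (induction w)
  case Nil
  then show ?case by (simp add: depth_eq_reduced)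
next
  case (Cons x w)
  then obtain u v where uv: "w = u @ v" "count_list v (Suc j) = count_list v j + depth j w"
    by blast
  obtain r s where rs: "reduced j (filter (\<lambda>x. x = j \<or> x = Suc j) w) = (r, s)"
    by fastforce
  show ?case
  proof (cases "x = Suc j \<and> r = 0")
    case True
    \<comment> \<open>Only here does the depth grow. Since \<open>r\<close> stays 0, the balance
      makes the whole word \<open>x # w\<close> the new witness; in the other case the old suffix
      still serves.\<close>
    then have "count_list (x # w) (Suc j) = count_list (x # w) j + depth j (x # w)"
      using reduced_balance[OF rs] rs by (simp add: depth_eq_reduced)
    then show ?thesis by (metis append_Nil)
  next
    case False
    then have "depth j (x # w) = depth j w"
      using rs by (auto simp: depth_eq_reduced)
    then show ?thesis using uv by (metis append_Cons)
  qed
qed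

lemma count_list_eq_card: "count_list xs x = card {c. c < length xs \<and> xs ! c = x}"
  by (simp add: count_list_eq_length_filter length_filter_conv_card eq_commute)

text \<open>Strictness lets a column contain \<open>x\<close> at most once, so occurrences
  correspond to columns.\<close>

lemma count_concat_eq_card_columns:
  fixes Rs :: "'a::order list list"
  assumes "sorted_wrt (\<lambda>p q. \<forall>c<n. p ! c < q ! c) Rs" and "\<forall>p \<in> set Rs. length p = n"
  shows "count_list (concat Rs) x = card {c. c < n \<and> (\<exists>p \<in> set Rs. p ! c = x)}"
  using assms
proof (induction Rs)
  case Nil
  then show ?case by simp
next
  case (Cons R Rs)
  let ?P = "{c. c < n \<and> R ! c = x}" and ?Q = "{c. c < n \<and> (\<exists>p \<in> set Rs. p ! c = x)}"
  have "R ! c \<noteq> p ! c" if "p \<in> set Rs" "c < n" for p c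
    using Cons.prems(1) that by (simp add: less_imp_neq)
  then have "?P \<inter> ?Q = {}" by force
  moreover have "{c. c < n \<and> (\<exists>p \<in> set (R # Rs). p ! c = x)} = ?P \<union> ?Q" by auto
  ultimately have "card {c. c < n \<and> (\<exists>p \<in> set (R # Rs). p ! c = x)} = card ?P + card ?Q"
    by (simp add: card_Un_disjoint)
  then show ?case
    using Cons by (simp add: count_list_eq_card[of R])
qed

text \<open>The row \<open>R\<close> lies in both lists because a suffix of the reading word may cut
  through it.\<close>

lemma count_split_columns_le:
  assumes "sorted_wrt (\<lambda>p q. \<forall>c<n. p ! c < q ! c) (A @ R # B)"
    and "\<forall>p \<in> set (A @ R # B). length p = n"
  shows "count_list (concat (A @ [R])) (Suc j) + count_list (concat (R # B)) j \<le> n"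
proof -
  let ?P = "{c. c < n \<and> (\<exists>p \<in> set (A @ [R]). p ! c = Suc j)}"
  let ?Q = "{c. c < n \<and> (\<exists>q \<in> set (R # B). q ! c = j)}"
  have "count_list (concat (A @ [R])) (Suc j) = card ?P"
    using assms by (intro count_concat_eq_card_columns) (auto simp: sorted_wrt_append)
  moreover have "count_list (concat (R # B)) j = card ?Q"
    using assms by (intro count_concat_eq_card_columns) (auto simp: sorted_wrt_append)
  \<comment> \<open>Below an entry \<open>Suc j\<close> in a row of \<open>A @ [R]\<close>, a column
    has only larger entries, so from \<open>R\<close> on it stays above \<open>j\<close>.\<close>
  moreover have "?P \<inter> ?Q = {}"
    using assms(1) by (fastforce simp: sorted_wrt_append)
  then have "card ?P + card ?Q = card (?P \<union> ?Q)"
    by (simp add: card_Un_disjoint)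
  moreover have "card (?P \<union> ?Q) \<le> card {..<n}"
    by (intro card_mono) auto
  ultimately show ?thesis by simp
qed

lemma count_list_concat_rev: "count_list (concat (rev xss)) x = count_list (concat xss) x"
  by (induction xss) auto

text \<open>The letters of \<open>K\<close> already account for every position of the list.\<close>

lemma count_list_zero_of_full_counts:
  assumes "finite K" and "(\<Sum>k\<in>K. count_list xs k) = length xs" and "x \<notin> K"
  shows "count_list xs x = 0"
proof -
  have "(\<Sum>k\<in>K \<union> set xs. count_list xs k) = length xs"
    using assms(1) by (intro sum_count_set) auto
  moreover have "(\<Sum>k\<in>K \<union> set xs. count_list xs k) =
      (\<Sum>k\<in>K. count_list xs k) + (\<Sum>k\<in>set xs - K. count_list xs k)"
    using assms(1) by (metis Un_Diff_cancel Diff_disjoint List.finite_set finite_Diff sum.union_disjoint)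
  ultimately have "(\<Sum>k\<in>set xs - K. count_list xs k) = 0"
    using assms(2) by simp
  then show ?thesis
    using assms(3) by (cases "x \<in> set xs") (auto simp: count_list_0_iff)
qed

lemma SHST_rows:
  assumes "T \<in> SHST a b n"
  obtains R0 Rs where "T = R0 # Rs" "sorted R0" "\<forall>p \<in> set Rs. length p = n"
    "sorted_wrt (\<lambda>p q. \<forall>c<n. p ! c < q ! c) Rs"
proof -
  have shape: "map length T = n * (a + 1) # replicate b n" and ss: "semistandard T"
    using assms by (auto simp: SHST_def)
  obtain R0 Rs where T: "T = R0 # Rs" and Rs: "map length Rs = replicate b n"
    using shape by (cases T) auto
  have len: "\<forall>p \<in> set Rs. length p = n"
    using Rs by (metis image_eqI in_set_replicate list.set_map)
  \<comment> \<open>\<open>semistandard\<close> compares consecutive rows only; transitivity extends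
    this to all pairs of lower rows, which have equal length.\<close>
  have "transp (\<lambda>p q. \<forall>c<n. p ! c < (q ! c :: nat))"
    by (auto intro!: transpI intro: less_trans)
  moreover have "\<forall>c<n. Rs ! i ! c < Rs ! Suc i ! c" if "Suc i < length Rs" for i
  proof (intro allI impI)
    fix c assume "c < n"
    then have "c < length (T ! Suc (Suc i))" using that len T by simp
    then have "T ! Suc i ! c < T ! Suc (Suc i) ! c"
      using ss that T unfolding semistandard_def by (metis Suc_less_eq length_Cons)
    then show "Rs ! i ! c < Rs ! Suc i ! c" using T by simp
  qed
  ultimately have "sorted_wrt (\<lambda>p q. \<forall>c<n. p ! c < q ! c) Rs"
    by (simp add: sorted_wrt_iff_nth_Suc_transp)
  moreover have "sorted R0" using ss T by (simp add: semistandard_def)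
  ultimately show ?thesis using that T len by blast
qed

text \<open>\<open>SHST\<close> bounds the entries from above only through counting: the prescribed
  contents fill all \<open>n * (a + b + 1)\<close> boxes.\<close>

lemma SHST_count_zero:
  assumes "T \<in> SHST a b n" and "a + b + 1 < k"
  shows "count_list (concat T) k = 0"
proof (rule count_list_zero_of_full_counts[where K = "{1..a + b + 1}"])
  have shape: "map length T = n * (a + 1) # replicate b n"
    and counts: "\<forall>k \<in> {1..a + b + 1}. count_list (concat T) k = n"
    using assms(1) by (auto simp: SHST_def)
  have "length (concat T) = n * (a + 1) + b * n"
    using shape by (simp add: length_concat sum_list_replicate)
  then show "(\<Sum>k\<in>{1..a + b + 1}. count_list (concat T) k) = length (concat T)"
    using counts by (simp add: algebra_simps)
qed (use assms in auto)

lemma suffix_count_le: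
  assumes "T \<in> SHST a b n" and "1 \<le> j" and "rw T = u @ v"
  shows "count_list v (Suc j) \<le> count_list v j + count_list (hd T) (Suc j)"
proof (cases "j \<le> a + b")
  case False
  then have "count_list (rw T) (Suc j) = 0"
    using SHST_count_zero[OF assms(1)] by (simp add: rw_def count_list_concat_rev)
  then show ?thesis using assms(3) by simp
next
  case True
  then have n: "count_list (concat T) j = n"
    using assms(1,2) by (auto simp: SHST_def)
  obtain R0 Rs where T: "T = R0 # Rs" and "sorted R0" and len: "\<forall>p \<in> set Rs. length p = n"
    and strict: "sorted_wrt (\<lambda>p q. \<forall>c<n. p ! c < q ! c) Rs"
    by (rule SHST_rows[OF assms(1)])
  \<comment> \<open>Rows are read from the bottom, so \<open>C\<close> holds the rows below the one
    where \<open>v\<close> begins, and \<open>D\<close> those above it.\<close>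
  obtain C p q D where split: "rev T = C @ (p @ q) # D" and v: "v = q @ concat D"
    using assms(3) T unfolding rw_def concat_eq_append_conv by (auto split: if_splits)
  have T_split: "T = rev D @ (p @ q) # rev C"
    using arg_cong[OF split, of rev] by simp
  show ?thesis
  proof (cases "rev D")
    case Nil
    then show ?thesis using T_split v by simp
  next
    case (Cons E A)
    then have A: "E = R0" "Rs = A @ (p @ q) # rev C" and D: "D = rev A @ [R0]"
      using T T_split by (auto simp: rev_eq_Cons_iff)
    \<comment> \<open>The letters \<open>j\<close> missing from \<open>v\<close> lie in
      \<open>p\<close> and \<open>rev C\<close>; counting all of \<open>p @ q\<close> on both sides
      only enlarges the left-hand side.\<close>
    have "count_list (concat (A @ [p @ q])) (Suc j) + count_list (concat ((p @ q) # rev C)) j \<le> n"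
      using strict len unfolding A(2) by (rule count_split_columns_le)
    then show ?thesis
      using n unfolding T A v D by (simp add: count_list_concat_rev)
  qed
qed

lemma sorted_suffix_count:
  assumes "sorted xs"
  obtains u v where "xs = u @ v" "count_list v (Suc j) = count_list xs (Suc j)" "count_list v j = 0"
proof
  show "xs = takeWhile (\<lambda>x. x \<le> j) xs @ dropWhile (\<lambda>x. x \<le> j) xs" by simp
  have "Suc j \<notin> set (takeWhile (\<lambda>x. x \<le> j) xs)" using set_takeWhileD by fastforce
  then show "count_list (dropWhile (\<lambda>x. x \<le> j) xs) (Suc j) = count_list xs (Suc j)"
    by (metis add_0 count_list_0_iff count_list_append takeWhile_dropWhile_id)
  show "count_list (dropWhile (\<lambda>x. x \<le> j) xs) j = 0"
    using assms by (induction xs) (auto simp: count_list_0_iff)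
qed

text \<open>There is no upper bound on \<open>j\<close>, since comparing whole depth sequences
  involves every index; beyond \<open>a + b\<close> both sides vanish.\<close>

lemma depth_rw_SHST:
  assumes "T \<in> SHST a b n" and "1 \<le> j"
  shows "depth j (rw T) = count_list (hd T) (Suc j)"
proof (rule antisym)
  obtain u v where "rw T = u @ v" "count_list v (Suc j) = count_list v j + depth j (rw T)"
    using depth_attained_by_suffix by metis
  then show "depth j (rw T) \<le> count_list (hd T) (Suc j)"
    using suffix_count_le[OF assms] by (metis nat_add_left_cancel_le)
next
  obtain R0 Rs where T: "T = R0 # Rs" and "sorted R0"
    using SHST_rows[OF assms(1)] by metis
  then obtain u v where uv: "R0 = u @ v" "count_list v (Suc j) = count_list R0 (Suc j)"
    "count_list v j = 0"
    using sorted_suffix_count by metis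
  have "rw T = (concat (rev Rs) @ u) @ v" using T uv by (simp add: rw_def)
  then show "count_list (hd T) (Suc j) \<le> depth j (rw T)"
    using count_suffix_le_depth[of v j "concat (rev Rs) @ u"] uv(2,3) T by simp
qed

theorem mainTheorem5:
  fixes a b n :: nat and T :: "nat list list"
  assumes "n \<ge> 1" and "T \<in> SHST a b n"
  shows "(\<forall>T' \<in> SHST a b n. hd T' = hd T \<longrightarrow> depth_seq (rw T') = depth_seq (rw T)) \<and>
         (\<forall>j \<in> {1..a + b}. depth j (rw T) = count_list (hd T) (j + 1))"
  using assms(2) by (auto simp: depth_seq_def fun_eq_iff depth_rw_SHST)

end
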